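(* Let $m\ge4$ and let $A$ be an independent set of vertices in $H_m$. Then $|A|\le 2m+\sum_{i\in\mathbb{Z}_m}\chi[A_1(i)\ne\emptyset]$.
   Context: For $m\ge4$, $H_m$ is the $4$-graph with vertex set $\mathbb{Z}_m\times\mathbb{Z}_2^2\times\mathbb{Z}_2^2\times\mathbb{Z}_2^2$, vertices written $(i,x,y,z)$, in which four distinct vertices form an edge iff they can be labeled $v_1,v_2,v_3,v_4$ so that one of the following holds (indices $i$ in $\mathbb{Z}_m$): (1) $v_t=(i,x,y,z_t)$ for $t=1,2,3,4$; (2) $v_t=(i,x_t,y_t,z_t)$ for $t=1,\dots,4$, with $x_1+x_2+x_3+x_4=0$ and $(x_k,y_k)\ne(x_l,y_l)$ for $k\ne l$; (3) $v_1=(i,x_1,y_1',z_1')$, $v_2=(i,x_1,y_1'',z_1'')$, $v_3=(i+1,x_2',y_2',z_2')$, $v_4=(i+1,x_2'',y_2'',z_2'')$ with $y_1'\ne y_1''$ and $y_1'+y_1''+x_2'+x_2''=0$; (4) $v_1=(i,x_1,y_1,z_1')$, $v_2=(i,x_1,y_1,z_1'')$ with $z_1'\ne z_1''$, and either (a) $v_3=(i,x_2,y_2,z_2')$, $v_4=(i,x_2,y_2,z_2'')$ with $(x_1,y_1)\ne(x_2,y_2)$ and $z_2'\ne z_2''$; or (b) $v_3=(i+2,x_2,y_2',z_2')$, $v_4=(i+2,x_2,y_2'',z_2'')$ with $y_2'\ne y_2''$; or (c) $v_3=(i+3,x_2',y_2',z_2')$, $v_4=(i+3,x_2'',y_2'',z_2'')$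 with $z_1'+z_1''+x_2'+x_2''=0$. A vertex set is independent if it contains no edge. For a vertex set $A$: $A_1(i)=\{x\in\mathbb{Z}_2^2:\exists y,z,\ (i,x,y,z)\in A\}$. $\chi[B]$ is $1$ if condition $B$ holds and $0$ otherwise. *)

theory Defs
  imports Main "HOL-Library.Z2" "HOL-Library.Product_Plus"
begin

text \<open>The group \<open>\<int>\<^sub>2\<^sup>2\<close>, with the componentwise addition from Product_Plus.\<close>

type_synonym z22 = "bit \<times> bit"

text \<open>\<open>\<int>\<^sub>m\<close> is represented by \<open>{..<m}\<close>, with addition modulo \<open>m\<close>.\<close>

type_synonym vertex = "nat \<times> z22 \<times> z22 \<times> z22"

definition verts :: "nat \<Rightarrow> vertex set" where
  "verts m = {..<m} \<times> UNIV"

text \<open>The predicate does not demand that the four vertices are distinct, nor that they lie in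
  \<open>verts m\<close>; both requirements are imposed in \<open>edges\<close>. The variables \<open>a\<close>, \<open>b\<close> mark the two
  members of a pair (one prime, two primes).\<close>

inductive edge_labelling :: "nat \<Rightarrow> vertex \<Rightarrow> vertex \<Rightarrow> vertex \<Rightarrow> vertex \<Rightarrow> bool" for m where
  type1: "edge_labelling m (i, x, y, z1) (i, x, y, z2) (i, x, y, z3) (i, x, y, z4)"
| type2: "edge_labelling m (i, x1, y1, z1) (i, x2, y2, z2) (i, x3, y3, z3) (i, x4, y4, z4)"
    if "x1 + x2 + x3 + x4 = 0"
      and "distinct [(x1, y1), (x2, y2), (x3, y3), (x4, y4)]"
| type3: "edge_labelling m (i, x1, y1a, z1a) (i, x1, y1b, z1b)
      ((i + 1) mod m, x2a, y2a, z2a) ((i + 1) mod m, x2b, y2b, z2b)"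
    if "y1a \<noteq> y1b" and "y1a + y1b + x2a + x2b = 0"
| type4a: "edge_labelling m (i, x1, y1, z1a) (i, x1, y1, z1b)
      (i, x2, y2, z2a) (i, x2, y2, z2b)"
    if "z1a \<noteq> z1b" and "(x1, y1) \<noteq> (x2, y2)" and "z2a \<noteq> z2b"
| type4b: "edge_labelling m (i, x1, y1, z1a) (i, x1, y1, z1b)
      ((i + 2) mod m, x2, y2a, z2a) ((i + 2) mod m, x2, y2b, z2b)"
    if "z1a \<noteq> z1b" and "y2a \<noteq> y2b"
| type4c: "edge_labelling m (i, x1, y1, z1a) (i, x1, y1, z1b)
      ((i + 3) mod m, x2a, y2a, z2a) ((i + 3) mod m, x2b, y2b, z2b)"
    if "z1a \<noteq> z1b" and "z1a + z1b + x2a + x2b = 0"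

definition edges :: "nat \<Rightarrow> vertex set set" where
  "edges m = {{v1, v2, v3, v4} | v1 v2 v3 v4.
     {v1, v2, v3, v4} \<subseteq> verts m \<and> distinct [v1, v2, v3, v4] \<and> edge_labelling m v1 v2 v3 v4}"

definition indep_set :: "nat \<Rightarrow> vertex set \<Rightarrow> bool" where
  "indep_set m A \<longleftrightarrow> A \<subseteq> verts m \<and> (\<forall>e \<in> edges m. \<not> e \<subseteq> A)"

definition proj1 :: "vertex set \<Rightarrow> nat \<Rightarrow> z22 set" where
  "proj1 A i = {x. \<exists>y z. (i, x, y, z) \<in> A}"

end

theory Submission
  imports Defs "HOL-Number_Theory.Cong"
begin

text \<open>In layer \<open>i\<close> at most one pair \<open>(x, y)\<close> carries several \<open>z\<close>, and at most one \<open>x\<close> carries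
  several \<open>y\<close>. So a nonempty layer has at most \<open>1 + a i + f i + e i\<close> vertices, where \<open>a i\<close>, \<open>f i\<close>
  and \<open>e i\<close> are the excesses over 1 of the numbers of \<open>x\<close>-values, of \<open>y\<close>-values over the
  exceptional \<open>x\<close> and of \<open>z\<close>-values over the exceptional \<open>(x, y)\<close>, all at most 2. A subset of
  \<open>\<int>\<^sub>2\<^sup>2\<close> with three elements realises all nonzero differences, so edges of types (3) and (4c) force
  \<open>f (i+2) + a (i+3) \<le> 2\<close> and \<open>e i + a (i+3) \<le> 2\<close>, while (4b) makes \<open>e i\<close> or \<open>f (i+2)\<close> vanish.
  Hence \<open>e i + f (i+2) + a (i+3) \<le> 2\<close>, and summing over \<open>i\<close> gives the bound.\<close>

section \<open>Counting with one exceptional fibre\<close>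

text \<open>The second hypothesis leaves at most one fibre of \<open>g\<close> with several
  elements, and off that fibre \<open>g\<close> is injective. If there is none, any \<open>p\<close>
  serves.\<close>

lemma card_le_card_image_plus_fibre:
  assumes "finite S"
    and "\<And>s s' t t'. s \<in> S \<Longrightarrow> s' \<in> S \<Longrightarrow> t \<in> S \<Longrightarrow> t' \<in> S \<Longrightarrow> s \<noteq> s' \<Longrightarrow> t \<noteq> t' \<Longrightarrow>
      g s = g s' \<Longrightarrow> g t = g t' \<Longrightarrow> g s = g t"
  shows "\<exists>p. card S \<le> card (g ` S) + (card {s \<in> S. g s = p} - 1)"
proof (cases "inj_on g S")
  case True
  then show ?thesis by (simp add: card_image)
next
  case False
  then obtain t t' where t: "t \<in> S" "t' \<in> S" "t \<noteq> t'" "g t = g t'"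
    by (auto simp: inj_on_def)
  define F where "F = {s \<in> S. g s = g t}"
  have "inj_on g (S - F)"
  proof (rule inj_onI, rule ccontr)
    fix s s' assume s: "s \<in> S - F" "s' \<in> S - F" "g s = g s'" "s \<noteq> s'"
    then have "g s = g t" using assms(2)[of s s' t t'] t by blast
    then show False using s(1) by (simp add: F_def)
  qed
  \<comment> \<open>The image also counts the large fibre once; this accounts for the subtracted
    1.\<close>
  moreover have "g t \<notin> g ` (S - F)" by (auto simp: F_def)
  ultimately have "card (insert (g t) (g ` (S - F))) = Suc (card (S - F))"
    using assms(1) by (simp add: card_image)
  moreover have "card (insert (g t) (g ` (S - F))) \<le> card (g ` S)"
    using assms(1) t by (intro card_mono) auto
  moreover have "S = (S - F) \<union> F" by (auto simp: F_def)
  then have "card S = card (S - F) + card F"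
    using assms(1) card_Un_disjoint[of "S - F" F] by (metis Diff_disjoint Int_commute finite_Un)
  ultimately have "card S \<le> card (g ` S) + (card F - 1)"
    by linarith
  then show ?thesis unfolding F_def by blast
qed

lemma two_elements:
  assumes "card T \<ge> 2"
  obtains x y where "x \<in> T" "y \<in> T" "x \<noteq> y"
proof -
  have "finite T" using assms by (cases "finite T") auto
  then have "\<exists>x \<in> T. \<exists>y \<in> T. x \<noteq> y"
    using assms card_le_Suc0_iff_eq[of T] by auto
  then show thesis using that by blast
qed

section \<open>Differences in the Klein four-group\<close>

lemma UNIV_z22: "(UNIV :: z22 set) = {(0, 0), (0, 1), (1, 0), (1, 1)}"
proof -
  have "x \<in> {(0, 0), (0, 1), (1, 0), (1, 1)}" for x :: z22
  proof (cases x)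
    case (Pair a b)
    have "a = 0 \<or> a = 1" "b = 0 \<or> b = 1" using bit_not_zero_iff by blast+
    then show ?thesis using Pair by blast
  qed
  then show ?thesis by blast
qed

lemma finite_z22 [simp]: "finite (T :: z22 set)"
proof (rule finite_subset)
  show "T \<subseteq> UNIV" by simp
  show "finite (UNIV :: z22 set)" unfolding UNIV_z22 by simp
qed

lemma card_UNIV_z22: "card (UNIV :: z22 set) = 4"
  by (simp add: UNIV_z22)

lemma card_z22_le_3:
  assumes "(T :: z22 set) \<noteq> UNIV"
  shows "card T \<le> 3"
proof -
  have "card T < card (UNIV :: z22 set)"
    using assms by (intro psubset_card_mono) auto
  then show ?thesis by (simp add: card_UNIV_z22)
qed

lemma z22_add_self [simp]: "(x :: z22) + x = 0"
  by (cases x) (auto simp: zero_prod_def)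

lemma z22_add_left_cancel [simp]: "(x :: z22) + (x + y) = y"
  by (simp flip: add.assoc)

lemma z22_add_eq_0_iff: "(x :: z22) + y = 0 \<longleftrightarrow> x = y"
  by (metis z22_add_left_cancel z22_add_self)

text \<open>\<open>T\<close> and its translate by \<open>d\<close> have at least six elements
  together, counted separately, so they meet in a group of order four.\<close>

lemma z22_difference_exists:
  assumes "card (T :: z22 set) \<ge> 3"
  shows "\<exists>x \<in> T. \<exists>y \<in> T. x + y = d"
proof (rule ccontr)
  assume *: "\<not> ?thesis"
  have "T \<inter> (+) d ` T = {}"
  proof (rule ccontr)
    assume "T \<inter> (+) d ` T \<noteq> {}"
    then obtain y where "y \<in> T" "d + y \<in> T" by auto
    moreover have "y + (d + y) = d" by (simp add: add.left_commute)
    ultimately show False using * by blast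
  qed
  then have "card (T \<union> (+) d ` T) = card T + card ((+) d ` T)"
    by (intro card_Un_disjoint) auto
  also have "card ((+) d ` T) = card T"
    by (intro card_image) (auto simp: inj_on_def)
  finally have "card T + card T = card (T \<union> (+) d ` T)" ..
  also have "\<dots> \<le> 4"
    using card_mono[of "UNIV :: z22 set" "T \<union> (+) d ` T"] by (simp add: card_UNIV_z22)
  finally show False using assms by simp
qed

text \<open>If the bound failed, one set would have three elements, hence realise every difference,
  and the other would have two. This is the common core of the bounds from edge types (3) and
  (4c).\<close>

lemma z22_disjoint_differences:
  fixes T U :: "z22 set"
  assumes "card T \<le> 3" "card U \<le> 3"
    and "\<And>x x' y y'. x \<in> T \<Longrightarrow> x' \<in> T \<Longrightarrow> y \<in> U \<Longrightarrow> y' \<in> U \<Longrightarrow> x \<noteq> x' \<Longrightarrow>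
      x + x' + y + y' \<noteq> 0"
  shows "(card T - 1) + (card U - 1) \<le> 2"
proof (rule ccontr)
  assume "\<not> ?thesis"
  then consider "card T \<ge> 2" "card U \<ge> 3" | "card U \<ge> 2" "card T \<ge> 3"
    using assms(1,2) by linarith
  then show False
  proof cases
    case 1
    obtain x x' where "x \<in> T" "x' \<in> T" "x \<noteq> x'" using two_elements[OF 1(1)] .
    moreover obtain y y' where "y \<in> U" "y' \<in> U" "y + y' = x + x'"
      using z22_difference_exists[OF 1(2)] by blast
    ultimately show False
      using assms(3) by (metis add.assoc z22_add_self)
  next
    case 2
    obtain y y' where y: "y \<in> U" "y' \<in> U" "y \<noteq> y'" using two_elements[OF 2(1)] .
    moreover obtain x x' where x: "x \<in> T" "x' \<in> T" "x + x' = y + y'"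
      using z22_difference_exists[OF 2(2)] by blast
    \<comment> \<open>Here distinctness was chosen in \<open>U\<close>; the equal differences carry
      it over to \<open>T\<close>.\<close>
    moreover have "x \<noteq> x'" using x y by (metis z22_add_eq_0_iff)
    ultimately show False
      using assms(3) by (metis add.assoc z22_add_self)
  qed
qed

text \<open>An injective self-map of a finite set permutes it. This later regroups the excesses of
  different layers.\<close>

lemma sum_shift_mod:
  fixes h :: "nat \<Rightarrow> nat"
  shows "(\<Sum>i<m. h ((i + k) mod m)) = (\<Sum>i<m. h i)"
proof (rule sum.reindex_bij_betw)
  have "inj_on (\<lambda>i. (i + k) mod m) {..<m}"
    by (auto simp: inj_on_def cong_add_rcancel_nat cong_def[symmetric] cong_less_modulus_unique_nat)
  moreover have "(\<lambda>i. (i + k) mod m) ` {..<m} \<subseteq> {..<m}"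
    by auto
  ultimately show "bij_betw (\<lambda>i. (i + k) mod m) {..<m} {..<m}"
    by (simp add: bij_betw_def endo_inj_surj)
qed

section \<open>Bounds inside one layer\<close>

text \<open>In this form a rule of \<open>edge_labelling\<close> can be plugged in directly, and a
  contradiction only needs the four vertices to be distinct.\<close>

lemma indep_setD:
  assumes "indep_set m A" "edge_labelling m v1 v2 v3 v4"
    and "v1 \<in> A" "v2 \<in> A" "v3 \<in> A" "v4 \<in> A"
  shows "\<not> distinct [v1, v2, v3, v4]"
proof
  assume "distinct [v1, v2, v3, v4]"
  moreover have "{v1, v2, v3, v4} \<subseteq> verts m"
    using assms unfolding indep_set_def by auto
  ultimately have "{v1, v2, v3, v4} \<in> edges m"
    unfolding edges_def using assms(2) by (intro CollectI exI conjI) (rule refl)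
  then show False
    using assms unfolding indep_set_def by auto
qed

definition proj2 :: "vertex set \<Rightarrow> nat \<Rightarrow> z22 \<Rightarrow> z22 set" where
  "proj2 A i x = {y. \<exists>z. (i, x, y, z) \<in> A}"

definition proj3 :: "vertex set \<Rightarrow> nat \<Rightarrow> z22 \<Rightarrow> z22 \<Rightarrow> z22 set" where
  "proj3 A i x y = {z. (i, x, y, z) \<in> A}"

text \<open>The four elements of the group sum to zero, so one vertex over each of them would give
  an edge of type (2).\<close>

lemma card_proj1_le:
  assumes "indep_set m A"
  shows "card (proj1 A i) \<le> 3"
proof (rule card_z22_le_3, rule notI)
  assume "proj1 A i = UNIV"
  then have "\<forall>x. \<exists>y z. (i, x, y, z) \<in> A" unfolding proj1_def by blast
  then obtain y z where *: "\<And>x. (i, x, y x, z x) \<in> A" by metis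
  show False
    using indep_setD[OF assms type2 * * * *, of "(0, 0)" "(0, 1)" "(1, 0)" "(1, 1)"]
    by (simp add: zero_prod_def)
qed

text \<open>Again type (2): four copies of the same \<open>x\<close> sum to zero.\<close>

lemma card_proj2_le:
  assumes "indep_set m A"
  shows "card (proj2 A i x) \<le> 3"
proof (rule card_z22_le_3, rule notI)
  assume "proj2 A i x = UNIV"
  then have "\<forall>y. \<exists>z. (i, x, y, z) \<in> A" unfolding proj2_def by blast
  then obtain z where *: "\<And>y. (i, x, y, z y) \<in> A" by metis
  show False
    using indep_setD[OF assms type2 * * * *, of "(0, 0)" "(0, 1)" "(1, 0)" "(1, 1)"]
    by (simp add: add.assoc)
qed

lemma card_proj3_le:
  assumes "indep_set m A"
  shows "card (proj3 A i x y) \<le> 3"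
proof (rule card_z22_le_3, rule notI)
  assume "proj3 A i x y = UNIV"
  then have *: "\<And>z. (i, x, y, z) \<in> A" by (auto simp: proj3_def)
  show False
    using indep_setD[OF assms type1 * * * *, of "(0, 0)" "(0, 1)" "(1, 0)" "(1, 1)"]
    by simp
qed

text \<open>The coordinates \<open>z\<close> and then \<open>y\<close> are forgotten, with one
  exceptional fibre at each stage. The two exceptional fibres may lie over different first
  coordinates, hence separate witnesses \<open>x\<close> and \<open>x'\<close>.\<close>

lemma card_layer_le:
  assumes "indep_set m A"
  shows "\<exists>x x' y'. card {v \<in> A. fst v = i} \<le>
    card (proj1 A i) + (card (proj2 A i x) - 1) + (card (proj3 A i x' y') - 1)"
proof -
  define L where "L = {v. (i, v) \<in> A}"
  define g :: "z22 \<times> z22 \<times> z22 \<Rightarrow> z22 \<times> z22" where "g = (\<lambda>(x, y, z). (x, y))"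
  have "finite (UNIV \<times> UNIV \<times> UNIV :: (z22 \<times> z22 \<times> z22) set)"
    by (intro finite_cartesian_product finite_z22)
  then have finL: "finite L"
    by (rule rev_finite_subset) auto
  define P where "P = g ` L"
  have finP: "finite P"
    using finL by (simp add: P_def)
  have P_iff: "(x, y) \<in> P \<longleftrightarrow> y \<in> proj2 A i x" for x y
  proof
    assume "(x, y) \<in> P"
    then obtain v where "v \<in> L" "(x, y) = g v" unfolding P_def by blast
    then have "(x, y, snd (snd v)) \<in> L" by (cases v) (simp add: g_def)
    then show "y \<in> proj2 A i x" unfolding L_def proj2_def by blast
  next
    assume "y \<in> proj2 A i x"
    then obtain z where "(x, y, z) \<in> L" unfolding L_def proj2_def by blast
    then show "(x, y) \<in> P" unfolding P_def by (rule rev_image_eqI) (simp add: g_def)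
  qed
  \<comment> \<open>Two large fibres of \<open>g\<close> would contain an edge of type (4a).\<close>
  have "\<exists>p. card L \<le> card P + (card {s \<in> L. g s = p} - 1)" unfolding P_def
  proof (rule card_le_card_image_plus_fibre[OF finL], rule ccontr)
    fix s s' t t' assume *: "s \<in> L" "s' \<in> L" "t \<in> L" "t' \<in> L" "s \<noteq> s'" "t \<noteq> t'"
      "g s = g s'" "g t = g t'" "g s \<noteq> g t"
    obtain x1 y1 z1 z1' where s: "s = (x1, y1, z1)" "s' = (x1, y1, z1')" "z1 \<noteq> z1'"
      using * by (cases s, cases s') (auto simp: g_def)
    obtain x2 y2 z2 z2' where t: "t = (x2, y2, z2)" "t' = (x2, y2, z2')" "z2 \<noteq> z2'"
      using * by (cases t, cases t') (auto simp: g_def)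
    have ne: "(x1, y1) \<noteq> (x2, y2)" using * s t by (auto simp: g_def)
    show False
      using indep_setD[OF assms type4a[OF s(3) ne t(3)], of i] * s t ne by (auto simp: L_def)
  qed
  then obtain x' y' where 1: "card L \<le> card P + (card {s \<in> L. g s = (x', y')} - 1)"
    by auto
  have "\<exists>p. card P \<le> card (fst ` P) + (card {s \<in> P. fst s = p} - 1)"
  proof (rule card_le_card_image_plus_fibre[OF finP], rule ccontr)
    fix s s' t t' assume *: "s \<in> P" "s' \<in> P" "t \<in> P" "t' \<in> P" "s \<noteq> s'"
      "t \<noteq> t'" "fst s = fst s'" "fst t = fst t'" "fst s \<noteq> fst t"
    obtain x1 y1 y1' where s: "s = (x1, y1)" "s' = (x1, y1')" "y1 \<noteq> y1'"
      using * by (cases s, cases s') auto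
    obtain x2 y2 y2' where t: "t = (x2, y2)" "t' = (x2, y2')" "y2 \<noteq> y2'"
      using * by (cases t, cases t') auto
    \<comment> \<open>Repeated first coordinates cancel, so two large fibres would yield an edge of
      type (2).\<close>
    have "x1 + x1 + x2 + x2 = 0" by (simp add: add.assoc)
    moreover have "distinct [(x1, y1), (x1, y1'), (x2, y2), (x2, y2')]" using * s t by auto
    moreover obtain z1 z1' z2 z2' where
      "(i, x1, y1, z1) \<in> A" "(i, x1, y1', z1') \<in> A" "(i, x2, y2, z2) \<in> A" "(i, x2, y2', z2') \<in> A"
      using * unfolding s t P_iff proj2_def by blast
    ultimately show False
      using indep_setD[OF assms type2, of x1 x1 x2 x2 y1 y1' y2 y2' i z1 z1' z2 z2'] by auto
  qed
  then obtain x where 2: "card P \<le> card (fst ` P) + (card {s \<in> P. fst s = x} - 1)"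
    by auto
  have "fst ` P = proj1 A i"
    unfolding fst_eq_Domain set_eq_iff Domain_iff P_iff proj1_def proj2_def by blast
  moreover have "{s \<in> P. fst s = x} = Pair x ` proj2 A i x"
    by (auto simp: P_iff)
  then have "card {s \<in> P. fst s = x} = card (proj2 A i x)"
    by (simp add: card_image inj_on_def)
  moreover have "{s \<in> L. g s = (x', y')} = (\<lambda>z. (x', y', z)) ` proj3 A i x' y'"
    by (auto simp: L_def g_def proj3_def)
  then have "card {s \<in> L. g s = (x', y')} = card (proj3 A i x' y')"
    by (simp add: card_image inj_on_def)
  moreover have "{v \<in> A. fst v = i} = Pair i ` L"
    by (auto simp: L_def)
  then have "card {v \<in> A. fst v = i} = card L"
    by (simp add: card_image inj_on_def)
  ultimately have "card {v \<in> A. fst v = i} \<le>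
    card (proj1 A i) + (card (proj2 A i x) - 1) + (card (proj3 A i x' y') - 1)"
    using 1 2 by simp
  then show ?thesis by blast
qed

section \<open>Constraints between layers\<close>

text \<open>For shifts by 1, 2 and 3 with \<open>m\<close> at least 4, this separates the two pairs
  of an edge that joins two layers.\<close>

lemma mod_shift_neq:
  fixes i k m :: nat
  assumes "0 < k" "k < m" "i < m"
  shows "(i + k) mod m \<noteq> i"
  using assms by (cases "i + k < m") (auto simp: mod_if)

lemma proj2_proj1_le_2:
  assumes "m \<ge> 4" "indep_set m A" "i < m"
  shows "(card (proj2 A i x) - 1) + (card (proj1 A ((i + 1) mod m)) - 1) \<le> 2"
proof (rule z22_disjoint_differences[OF card_proj2_le card_proj1_le, OF assms(2) assms(2)], rule notI)
  fix y y' u u'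
  assume *: "y \<in> proj2 A i x" "y' \<in> proj2 A i x" "u \<in> proj1 A ((i + 1) mod m)"
    "u' \<in> proj1 A ((i + 1) mod m)" "y \<noteq> y'" "y + y' + u + u' = 0"
  \<comment> \<open>Needed for the last two vertices of the edge to be distinct.\<close>
  then have "u \<noteq> u'" by (metis add.assoc z22_add_eq_0_iff)
  moreover obtain w w' where "(i, x, y, w) \<in> A" "(i, x, y', w') \<in> A"
    using * unfolding proj2_def by blast
  moreover obtain b b' c c' where "((i + 1) mod m, u, b, c) \<in> A" "((i + 1) mod m, u', b', c') \<in> A"
    using * unfolding proj1_def by blast
  ultimately show False
    using * indep_setD[OF assms(2) type3[OF *(5,6)], of i x w w' b c b' c']
      mod_shift_neq[of 1 m i] assms by auto
qed

lemma proj3_proj1_le_2: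
  assumes "m \<ge> 4" "indep_set m A" "i < m"
  shows "(card (proj3 A i x y) - 1) + (card (proj1 A ((i + 3) mod m)) - 1) \<le> 2"
proof (rule z22_disjoint_differences[OF card_proj3_le card_proj1_le, OF assms(2) assms(2)], rule notI)
  fix z z' u u'
  assume *: "z \<in> proj3 A i x y" "z' \<in> proj3 A i x y" "u \<in> proj1 A ((i + 3) mod m)"
    "u' \<in> proj1 A ((i + 3) mod m)" "z \<noteq> z'" "z + z' + u + u' = 0"
  then have "u \<noteq> u'" by (metis add.assoc z22_add_eq_0_iff)
  moreover have "(i, x, y, z) \<in> A" "(i, x, y, z') \<in> A"
    using * unfolding proj3_def by blast+
  moreover obtain b b' c c' where "((i + 3) mod m, u, b, c) \<in> A" "((i + 3) mod m, u', b', c') \<in> A"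
    using * unfolding proj1_def by blast
  ultimately show False
    using * indep_setD[OF assms(2) type4c[OF *(5,6)], of i x y b c b' c']
      mod_shift_neq[of 3 m i] assms by auto
qed

lemma proj3_proj2_trivial:
  assumes "m \<ge> 4" "indep_set m A" "i < m"
  shows "card (proj3 A i x y) \<le> 1 \<or> card (proj2 A ((i + 2) mod m) u) \<le> 1"
proof (rule ccontr)
  assume "\<not> ?thesis"
  then have "card (proj3 A i x y) \<ge> 2" "card (proj2 A ((i + 2) mod m) u) \<ge> 2" by linarith+
  then obtain z z' w w' where *: "z \<in> proj3 A i x y" "z' \<in> proj3 A i x y" "z \<noteq> z'"
    "w \<in> proj2 A ((i + 2) mod m) u" "w' \<in> proj2 A ((i + 2) mod m) u" "w \<noteq> w'"
    using two_elements[of "proj3 A i x y"] two_elements[of "proj2 A ((i + 2) mod m) u"]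
    by metis
  then have "(i, x, y, z) \<in> A" "(i, x, y, z') \<in> A"
    unfolding proj3_def by blast+
  moreover obtain c c' where "((i + 2) mod m, u, w, c) \<in> A" "((i + 2) mod m, u, w', c') \<in> A"
    using * unfolding proj2_def by blast
  ultimately show False
    using * indep_setD[OF assms(2) type4b[OF *(3,6)], of i x y u c c']
      mod_shift_neq[of 2 m i] assms by auto
qed

theorem theorem3:
  fixes m :: nat and A :: "vertex set"
  assumes "m \<ge> 4"
    and "indep_set m A"
  shows "card A \<le> 2 * m + (\<Sum>i\<in>{..<m}. of_bool (proj1 A i \<noteq> {}))"
proof -
  \<comment> \<open>Abbreviating the bound lets the exceptional fibres be chosen as functions
    \<open>p\<close>, \<open>q\<close>, \<open>r\<close> of the layer.\<close>
  define Q where "Q i x x' y' \<longleftrightarrow> card {v \<in> A. fst v = i} \<le>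
      card (proj1 A i) + (card (proj2 A i x) - 1) + (card (proj3 A i x' y') - 1)" for i x x' y'
  have "\<exists>x x' y'. Q i x x' y'" for i
    unfolding Q_def by (rule card_layer_le[OF assms(2)])
  then obtain p q r where layer: "\<And>i. Q i (p i) (q i) (r i)"
    by metis
  define a where "a i = card (proj1 A i) - 1" for i
  define f where "f i = card (proj2 A i (p i)) - 1" for i
  define e where "e i = card (proj3 A i (q i) (r i)) - 1" for i
  have triple: "e i + f ((i + 2) mod m) + a ((i + 3) mod m) \<le> 2" if "i < m" for i
  proof -
    \<comment> \<open>The type (3) bound is applied at layer \<open>i + 2\<close>, so that it
      involves the same term \<open>a\<close> as the type (4c) bound at layer
      \<open>i\<close>.\<close>
    have "((i + 2) mod m + 1) mod m = (i + 3) mod m"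
      by (simp add: mod_simps numeral_3_eq_3)
    then have "f ((i + 2) mod m) + a ((i + 3) mod m) \<le> 2"
      using proj2_proj1_le_2[OF assms, of "(i + 2) mod m"] that by (simp add: f_def a_def)
    moreover have "e i + a ((i + 3) mod m) \<le> 2"
      using proj3_proj1_le_2[OF assms that] by (simp add: e_def a_def)
    moreover have "e i = 0 \<or> f ((i + 2) mod m) = 0"
      using proj3_proj2_trivial[OF assms that] by (auto simp: e_def f_def)
    ultimately show ?thesis by auto
  qed
  have "card A = card (\<Union>i<m. {v \<in> A. fst v = i})"
    using assms(2) by (intro arg_cong[of _ _ card]) (auto simp: indep_set_def verts_def)
  also have "\<dots> \<le> (\<Sum>i<m. card {v \<in> A. fst v = i})"
    by (rule card_UN_le) simp
  also have "\<dots> \<le> (\<Sum>i<m. of_bool (proj1 A i \<noteq> {}) + (e i + f i + a i))"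
  proof (rule sum_mono)
    fix i
    \<comment> \<open>Subtraction truncates at 0, so an empty layer contributes nothing
      here.\<close>
    have "card (proj1 A i) \<le> of_bool (proj1 A i \<noteq> {}) + a i" by (auto simp: a_def)
    then show "card {v \<in> A. fst v = i} \<le> of_bool (proj1 A i \<noteq> {}) + (e i + f i + a i)"
      using layer[of i] by (simp add: Q_def e_def f_def)
  qed
  also have "\<dots> = (\<Sum>i<m. of_bool (proj1 A i \<noteq> {}))
      + (\<Sum>i<m. e i + f ((i + 2) mod m) + a ((i + 3) mod m))"
    unfolding sum.distrib sum_shift_mod[of f 2 m] sum_shift_mod[of a 3 m] by simp
  also have "(\<Sum>i<m. e i + f ((i + 2) mod m) + a ((i + 3) mod m)) \<le> (\<Sum>i<m. 2)"
    using triple by (intro sum_mono) auto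
  finally show ?thesis by simp
qed

end
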